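(* Let $P:\mathbb C^{\mathrm{op}}\to\mathbf{Pos}$ be a primary doctrine, $X$ an object of $\mathbb C$ and $\varphi\in P(X)$, and let $P_{(X,\varphi)}$ be the associated Kleisli doctrine with canonical 1-arrow $(F_X,\mathfrak f):P\to P_{(X,\varphi)}$. If $P$ is a Heyting doctrine, then $P_{(X,\varphi)}$ is a Heyting doctrine, and $(F_X,\mathfrak f)$ is a Heyting homomorphism.
   Context: A doctrine is a functor $P:\mathbb C^{\mathrm{op}}\to\mathbf{Pos}$ with $\mathbb C$ a category with finite products and $\mathbf{Pos}$ the category of posets and monotone maps; the maps $P(f)$ are called reindexings. It is primary if every $P(A)$ has finite meets ($\wedge$, $\top$) and all reindexings preserve them. It is Heyting if every $P(A)$ is a Heyting algebra and all reindexings preserve $\wedge,\top,\to,\vee,\bot$. A 1-arrow (doctrine homomorphism) from $P:\mathbb C^{\mathrm{op}}\to\mathbf{Pos}$ to $R:\mathbb D^{\mathrm{op}}\to\mathbf{Pos}$ is a pair $(F,\mathfrak f)$ with $F:\mathbb C\to\mathbb D$ a finite-product-preserving functor and $\mathfrak f:P\to R\circ F^{\mathrm{op}}$ natural; it is Heyting if $P,R$ are Heyting and each $\mathfrak f_A$ preserves $\wedge,\top,\to,\vee,\bot$. Kleisli doctrine (the Kleisli object of the comonad on $P$ given by $X\times-$ and $\alpha\mapsto P(\mathrm{pr}_1)(\varphi)\wedge P(\mathrm{pr}_2)(\alpha)$). The category $\mathbb C_X$ has the same objects as $\mathbb C$; an arrow $g:A\rightsquigarrow B$ in $\mathbb C_X$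 is a $\mathbb C$-arrow $g:X\times A\to B$; the identity of $A$ is $\mathrm{pr}_2:X\times A\to A$; the composite of $g:A\rightsquigarrow B$ and $h:B\rightsquigarrow C$ is $h\langle\mathrm{pr}_1,g\rangle$. It has finite products, given on objects by those of $\mathbb C$. The doctrine $P_{(X,\varphi)}:\mathbb C_X^{\mathrm{op}}\to\mathbf{Pos}$ has $P_{(X,\varphi)}(A)=\{\alpha\in P(X\times A)\mid\alpha\le P(\mathrm{pr}_1)(\varphi)\}$ with the order of $P(X\times A)$, and reindexing along $g:A\rightsquigarrow B$ is the restriction of $P(\langle\mathrm{pr}_1,g\rangle)$. The 1-arrow $(F_X,\mathfrak f):P\to P_{(X,\varphi)}$: $F_X:\mathbb C\to\mathbb C_X$ is the identity on objects and sends $f:A\to B$ to $f\,\mathrm{pr}_2:A\rightsquigarrow B$; $\mathfrak f_A(\alpha)=P(\mathrm{pr}_1)(\varphi)\wedge P(\mathrm{pr}_2)(\alpha)$, for $\mathrm{pr}_1,\mathrm{pr}_2$ the projections from $X\times A$. *)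

theory Defs
  imports "HOL-Algebra.Lattice"
begin

section \<open>Categories with finite products\<close>

text \<open>
  A category is given by its hom-families. Hom-sets for distinct pairs of objects need not be
  disjoint, so a bare arrow does not determine its domain and codomain. Every operation on arrows
  therefore takes the objects involved as arguments:
  for \<open>f : A \<rightarrow> B\<close> and \<open>g : B \<rightarrow> D\<close> the composite \<open>g f : A \<rightarrow> D\<close> is \<open>Compose C A B D g f\<close>.
  This is what allows an arrow of the Kleisli category below to literally be an arrow
  of the base: the objects \<open>X \<times> A\<close> and \<open>X \<times> A'\<close> may coincide for distinct \<open>A\<close> and \<open>A'\<close>.
\<close>

record ('o, 'm) cat =
  Ob :: "'o set"
  Hom :: "'o \<Rightarrow> 'o \<Rightarrow> 'm set"
  Ident :: "'o \<Rightarrow> 'm"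
  Compose :: "'o \<Rightarrow> 'o \<Rightarrow> 'o \<Rightarrow> 'm \<Rightarrow> 'm \<Rightarrow> 'm"

locale category =
  fixes C :: "('o, 'm) cat"
  assumes Ident_in_Hom: "A \<in> Ob C \<Longrightarrow> Ident C A \<in> Hom C A A"
    and Compose_in_Hom:
      "\<lbrakk>A \<in> Ob C; B \<in> Ob C; D \<in> Ob C; f \<in> Hom C A B; g \<in> Hom C B D\<rbrakk>
        \<Longrightarrow> Compose C A B D g f \<in> Hom C A D"
    and Compose_Ident_left:
      "\<lbrakk>A \<in> Ob C; B \<in> Ob C; f \<in> Hom C A B\<rbrakk> \<Longrightarrow> Compose C A B B (Ident C B) f = f"
    and Compose_Ident_right:
      "\<lbrakk>A \<in> Ob C; B \<in> Ob C; f \<in> Hom C A B\<rbrakk> \<Longrightarrow> Compose C A A B f (Ident C A) = f"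
    and Compose_assoc:
      "\<lbrakk>A \<in> Ob C; B \<in> Ob C; D \<in> Ob C; E \<in> Ob C;
        f \<in> Hom C A B; g \<in> Hom C B D; h \<in> Hom C D E\<rbrakk>
        \<Longrightarrow> Compose C A D E h (Compose C A B D g f) = Compose C A B E (Compose C B D E h g) f"

definition is_terminal :: "('o, 'm) cat \<Rightarrow> 'o \<Rightarrow> bool" where
  "is_terminal C T \<longleftrightarrow> T \<in> Ob C \<and> (\<forall>A \<in> Ob C. \<exists>!f. f \<in> Hom C A T)"

definition is_product :: "('o, 'm) cat \<Rightarrow> 'o \<Rightarrow> 'o \<Rightarrow> 'o \<Rightarrow> 'm \<Rightarrow> 'm \<Rightarrow> bool" where
  "is_product C A B Q p q \<longleftrightarrow>
     A \<in> Ob C \<and> B \<in> Ob C \<and> Q \<in> Ob C \<and> p \<in> Hom C Q A \<and> q \<in> Hom C Q B \<and>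
     (\<forall>Z \<in> Ob C. \<forall>f \<in> Hom C Z A. \<forall>g \<in> Hom C Z B.
        \<exists>!h. h \<in> Hom C Z Q \<and> Compose C Z Q A p h = f \<and> Compose C Z Q B q h = g)"

locale finite_product_category = category C for C :: "('o, 'm) cat" +
  assumes terminal_exists: "\<exists>T. is_terminal C T"
    and product_exists: "\<lbrakk>A \<in> Ob C; B \<in> Ob C\<rbrakk> \<Longrightarrow> \<exists>Q p q. is_product C A B Q p q"

text \<open>
  Having finite products is a property of the category; the notation \<open>A \<times> B\<close> refers to
  a choice of binary products, which is kept separate and is arbitrary.
\<close>

record ('o, 'm) product_choice =
  prod_ob :: "'o \<Rightarrow> 'o \<Rightarrow> 'o"
  pr1 :: "'o \<Rightarrow> 'o \<Rightarrow> 'm"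
  pr2 :: "'o \<Rightarrow> 'o \<Rightarrow> 'm"

definition chosen_products :: "('o, 'm) cat \<Rightarrow> ('o, 'm) product_choice \<Rightarrow> bool" where
  "chosen_products C \<pi> \<longleftrightarrow>
     (\<forall>A \<in> Ob C. \<forall>B \<in> Ob C. is_product C A B (prod_ob \<pi> A B) (pr1 \<pi> A B) (pr2 \<pi> A B))"

text \<open>\<open>pairing C \<pi> Z A B f g\<close> is \<open>\<langle>f, g\<rangle> : Z \<rightarrow> A \<times> B\<close> for \<open>f : Z \<rightarrow> A\<close> and \<open>g : Z \<rightarrow> B\<close>.\<close>

definition pairing ::
    "('o, 'm) cat \<Rightarrow> ('o, 'm) product_choice \<Rightarrow> 'o \<Rightarrow> 'o \<Rightarrow> 'o \<Rightarrow> 'm \<Rightarrow> 'm \<Rightarrow> 'm" where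
  "pairing C \<pi> Z A B f g =
     (THE h. h \<in> Hom C Z (prod_ob \<pi> A B) \<and>
        Compose C Z (prod_ob \<pi> A B) A (pr1 \<pi> A B) h = f \<and>
        Compose C Z (prod_ob \<pi> A B) B (pr2 \<pi> A B) h = g)"

locale cat_functor = C: category C + D: category D
  for C :: "('o, 'm) cat" and D :: "('p, 'n) cat" +
  fixes Fo :: "'o \<Rightarrow> 'p" and Fm :: "'o \<Rightarrow> 'o \<Rightarrow> 'm \<Rightarrow> 'n"
  assumes Fo_in_Ob: "A \<in> Ob C \<Longrightarrow> Fo A \<in> Ob D"
    and Fm_in_Hom: "\<lbrakk>A \<in> Ob C; B \<in> Ob C; f \<in> Hom C A B\<rbrakk> \<Longrightarrow> Fm A B f \<in> Hom D (Fo A) (Fo B)"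
    and Fm_Ident: "A \<in> Ob C \<Longrightarrow> Fm A A (Ident C A) = Ident D (Fo A)"
    and Fm_Compose:
      "\<lbrakk>A \<in> Ob C; B \<in> Ob C; E \<in> Ob C; f \<in> Hom C A B; g \<in> Hom C B E\<rbrakk>
        \<Longrightarrow> Fm A E (Compose C A B E g f) = Compose D (Fo A) (Fo B) (Fo E) (Fm B E g) (Fm A B f)"

text \<open>Products are preserved in the usual, non-strict sense: product cones go to product cones.\<close>

locale finite_product_functor = cat_functor C D Fo Fm
  for C :: "('o, 'm) cat" and D :: "('p, 'n) cat" and Fo Fm +
  assumes preserves_terminal: "is_terminal C T \<Longrightarrow> is_terminal D (Fo T)"
    and preserves_product:
      "is_product C A B Q p q \<Longrightarrow> is_product D (Fo A) (Fo B) (Fo Q) (Fm Q A p) (Fm Q B q)"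


section \<open>Heyting algebras\<close>

definition himp :: "('a, 'b) gorder_scheme \<Rightarrow> 'a \<Rightarrow> 'a \<Rightarrow> 'a" where
  "himp L x y = (SOME z. greatest L z {w \<in> carrier L. w \<sqinter>\<^bsub>L\<^esub> x \<sqsubseteq>\<^bsub>L\<^esub> y})"

locale heyting_algebra = bounded_lattice L for L :: "('a, 'b) gorder_scheme" (structure) +
  assumes himp_exists:
    "\<lbrakk>x \<in> carrier L; y \<in> carrier L\<rbrakk> \<Longrightarrow> \<exists>z. greatest L z {w \<in> carrier L. w \<sqinter> x \<sqsubseteq> y}"

definition preserves_finite_meets ::
    "('a, 'c) gorder_scheme \<Rightarrow> ('b, 'd) gorder_scheme \<Rightarrow> ('a \<Rightarrow> 'b) \<Rightarrow> bool" where
  "preserves_finite_meets L M h \<longleftrightarrow>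
     h \<top>\<^bsub>L\<^esub> = \<top>\<^bsub>M\<^esub> \<and>
     (\<forall>x \<in> carrier L. \<forall>y \<in> carrier L. h (x \<sqinter>\<^bsub>L\<^esub> y) = h x \<sqinter>\<^bsub>M\<^esub> h y)"

definition preserves_heyting ::
    "('a, 'c) gorder_scheme \<Rightarrow> ('b, 'd) gorder_scheme \<Rightarrow> ('a \<Rightarrow> 'b) \<Rightarrow> bool" where
  "preserves_heyting L M h \<longleftrightarrow>
     preserves_finite_meets L M h \<and>
     h \<bottom>\<^bsub>L\<^esub> = \<bottom>\<^bsub>M\<^esub> \<and>
     (\<forall>x \<in> carrier L. \<forall>y \<in> carrier L. h (x \<squnion>\<^bsub>L\<^esub> y) = h x \<squnion>\<^bsub>M\<^esub> h y) \<and>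
     (\<forall>x \<in> carrier L. \<forall>y \<in> carrier L. h (himp L x y) = himp M (h x) (h y))"


section \<open>Doctrines\<close>

text \<open>
  For \<open>f : A \<rightarrow> B\<close> the reindexing \<open>P(f) : P(B) \<rightarrow> P(A)\<close> is \<open>reindex P A B f\<close>.
\<close>

record ('o, 'm, 'e) doct =
  base :: "('o, 'm) cat"
  fibre :: "'o \<Rightarrow> 'e gorder"
  reindex :: "'o \<Rightarrow> 'o \<Rightarrow> 'm \<Rightarrow> 'e \<Rightarrow> 'e"

locale doctrine = finite_product_category "base P" for P :: "('o, 'm, 'e) doct" +
  assumes fibre_partial_order: "A \<in> Ob (base P) \<Longrightarrow> partial_order (fibre P A)"
    and reindex_closed:
      "\<lbrakk>A \<in> Ob (base P); B \<in> Ob (base P); f \<in> Hom (base P) A B\<rbrakk>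
        \<Longrightarrow> reindex P A B f \<in> carrier (fibre P B) \<rightarrow> carrier (fibre P A)"
    and reindex_isotone:
      "\<lbrakk>A \<in> Ob (base P); B \<in> Ob (base P); f \<in> Hom (base P) A B\<rbrakk>
        \<Longrightarrow> isotone (fibre P B) (fibre P A) (reindex P A B f)"
    and reindex_Ident:
      "\<lbrakk>A \<in> Ob (base P); \<alpha> \<in> carrier (fibre P A)\<rbrakk>
        \<Longrightarrow> reindex P A A (Ident (base P) A) \<alpha> = \<alpha>"
    and reindex_Compose:
      "\<lbrakk>A \<in> Ob (base P); B \<in> Ob (base P); D \<in> Ob (base P);
        f \<in> Hom (base P) A B; g \<in> Hom (base P) B D; \<alpha> \<in> carrier (fibre P D)\<rbrakk>
        \<Longrightarrow> reindex P A D (Compose (base P) A B D g f) \<alpha> = reindex P A B f (reindex P B D g \<alpha>)"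

locale primary_doctrine = doctrine P for P :: "('o, 'm, 'e) doct" +
  assumes fibre_meets: "A \<in> Ob (base P) \<Longrightarrow> lower_semilattice (fibre P A)"
    and fibre_top: "A \<in> Ob (base P) \<Longrightarrow> weak_partial_order_top (fibre P A)"
    and reindex_finite_meets:
      "\<lbrakk>A \<in> Ob (base P); B \<in> Ob (base P); f \<in> Hom (base P) A B\<rbrakk>
        \<Longrightarrow> preserves_finite_meets (fibre P B) (fibre P A) (reindex P A B f)"

locale heyting_doctrine = doctrine P for P :: "('o, 'm, 'e) doct" +
  assumes fibre_heyting: "A \<in> Ob (base P) \<Longrightarrow> heyting_algebra (fibre P A)"
    and reindex_heyting:
      "\<lbrakk>A \<in> Ob (base P); B \<in> Ob (base P); f \<in> Hom (base P) A B\<rbrakk>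
        \<Longrightarrow> preserves_heyting (fibre P B) (fibre P A) (reindex P A B f)"

locale doctrine_hom =
  P: doctrine P + R: doctrine R + finite_product_functor "base P" "base R" Fo Fm
  for P :: "('o, 'm, 'e) doct" and R :: "('p, 'n, 'd) doct" and Fo Fm +
  fixes \<ff> :: "'o \<Rightarrow> 'e \<Rightarrow> 'd"
  assumes component_closed:
      "A \<in> Ob (base P) \<Longrightarrow> \<ff> A \<in> carrier (fibre P A) \<rightarrow> carrier (fibre R (Fo A))"
    and component_isotone:
      "A \<in> Ob (base P) \<Longrightarrow> isotone (fibre P A) (fibre R (Fo A)) (\<ff> A)"
    and natural:
      "\<lbrakk>A \<in> Ob (base P); B \<in> Ob (base P); f \<in> Hom (base P) A B; \<alpha> \<in> carrier (fibre P B)\<rbrakk>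
        \<Longrightarrow> \<ff> A (reindex P A B f \<alpha>) = reindex R (Fo A) (Fo B) (Fm A B f) (\<ff> B \<alpha>)"

locale heyting_doctrine_hom =
  doctrine_hom P R Fo Fm \<ff> + P: heyting_doctrine P + R: heyting_doctrine R
  for P :: "('o, 'm, 'e) doct" and R :: "('p, 'n, 'd) doct" and Fo Fm \<ff> +
  assumes component_heyting:
    "A \<in> Ob (base P) \<Longrightarrow> preserves_heyting (fibre P A) (fibre R (Fo A)) (\<ff> A)"


section \<open>The Kleisli doctrine\<close>

definition kleisli_category ::
    "('o, 'm) cat \<Rightarrow> ('o, 'm) product_choice \<Rightarrow> 'o \<Rightarrow> ('o, 'm) cat" where
  "kleisli_category C \<pi> X =
     \<lparr>Ob = Ob C,
      Hom = (\<lambda>A B. Hom C (prod_ob \<pi> X A) B),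
      Ident = (\<lambda>A. pr2 \<pi> X A),
      Compose = (\<lambda>A B D h g.
        Compose C (prod_ob \<pi> X A) (prod_ob \<pi> X B) D h
          (pairing C \<pi> (prod_ob \<pi> X A) X B (pr1 \<pi> X A) g))\<rparr>"

definition kleisli_doctrine ::
    "('o, 'm, 'e) doct \<Rightarrow> ('o, 'm) product_choice \<Rightarrow> 'o \<Rightarrow> 'e \<Rightarrow> ('o, 'm, 'e) doct" where
  "kleisli_doctrine P \<pi> X \<phi> =
     \<lparr>base = kleisli_category (base P) \<pi> X,
      fibre = (\<lambda>A. (fibre P (prod_ob \<pi> X A))
        \<lparr>carrier := {\<alpha> \<in> carrier (fibre P (prod_ob \<pi> X A)).
           \<alpha> \<sqsubseteq>\<^bsub>fibre P (prod_ob \<pi> X A)\<^esub> reindex P (prod_ob \<pi> X A) X (pr1 \<pi> X A) \<phi>}\<rparr>),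
      reindex = (\<lambda>A B g. reindex P (prod_ob \<pi> X A) (prod_ob \<pi> X B)
        (pairing (base P) \<pi> (prod_ob \<pi> X A) X B (pr1 \<pi> X A) g))\<rparr>"

definition kleisli_functor_ob :: "'o \<Rightarrow> 'o" where
  "kleisli_functor_ob A = A"

definition kleisli_functor_hom ::
    "('o, 'm) cat \<Rightarrow> ('o, 'm) product_choice \<Rightarrow> 'o \<Rightarrow> 'o \<Rightarrow> 'o \<Rightarrow> 'm \<Rightarrow> 'm" where
  "kleisli_functor_hom C \<pi> X A B f = Compose C (prod_ob \<pi> X A) A B f (pr2 \<pi> X A)"

definition kleisli_component ::
    "('o, 'm, 'e) doct \<Rightarrow> ('o, 'm) product_choice \<Rightarrow> 'o \<Rightarrow> 'e \<Rightarrow> 'o \<Rightarrow> 'e \<Rightarrow> 'e" where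
  "kleisli_component P \<pi> X \<phi> A \<alpha> =
     reindex P (prod_ob \<pi> X A) X (pr1 \<pi> X A) \<phi>
       \<sqinter>\<^bsub>fibre P (prod_ob \<pi> X A)\<^esub> reindex P (prod_ob \<pi> X A) A (pr2 \<pi> X A) \<alpha>"

end

theory Submission
  imports Defs
begin

text \<open>
  The fibre of the Kleisli doctrine over \<open>A\<close> is the principal ideal of \<open>P(X \<times> A)\<close> below
  \<open>c = P(pr\<^sub>1)(\<phi>)\<close>. A principal ideal below \<open>c\<close> of a Heyting algebra is again a Heyting algebra, with
  the same meets, joins and bottom, top \<open>c\<close>, and implication \<open>c \<sqinter> (x \<rightarrow> y)\<close>; moreover
  \<open>c \<sqinter> -\<close> is a Heyting homomorphism onto it. Reindexing in the Kleisli doctrine is a reindexing of \<open>P\<close>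
  along an arrow over \<open>X\<close>, which maps the top of one ideal to the top of the other.
\<close>

section \<open>Principal ideals of Heyting algebras\<close>

text \<open>The library picks meets by Hilbert choice, so a value is computed by exhibiting a
  greatest lower bound and using antisymmetry. Only a partial order is assumed, which lets meets in
  an ideal be evaluated before the ideal is known to be a lattice. The two analogues below serve
  joins and implications.\<close>

lemma (in partial_order) meet_eqI:
  assumes "z \<in> carrier L" "z \<sqsubseteq> x" "z \<sqsubseteq> y"
    and "\<And>w. \<lbrakk>w \<in> carrier L; w \<sqsubseteq> x; w \<sqsubseteq> y\<rbrakk> \<Longrightarrow> w \<sqsubseteq> z"
    and "x \<in> carrier L" "y \<in> carrier L"
  shows "x \<sqinter> y = z"
proof -
  have "greatest L z (Lower L {x, y})"
    using assms by (auto simp: greatest_def Lower_def)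
  then show ?thesis
    unfolding meet_def inf_def by (blast intro: some_equality greatest_unique)
qed

lemma (in partial_order) join_eqI:
  assumes "z \<in> carrier L" "x \<sqsubseteq> z" "y \<sqsubseteq> z"
    and "\<And>w. \<lbrakk>w \<in> carrier L; x \<sqsubseteq> w; y \<sqsubseteq> w\<rbrakk> \<Longrightarrow> z \<sqsubseteq> w"
    and "x \<in> carrier L" "y \<in> carrier L"
  shows "x \<squnion> y = z"
proof -
  have "least L z (Upper L {x, y})"
    using assms by (auto simp: least_def Upper_def)
  then show ?thesis
    unfolding join_def sup_def by (blast intro: some_equality least_unique)
qed

lemma (in partial_order) himp_eqI:
  assumes "greatest L z {w \<in> carrier L. w \<sqinter> x \<sqsubseteq> y}"
  shows "himp L x y = z"
  using assms unfolding himp_def by (blast intro: some_equality greatest_unique)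

section \<open>Residuation and distributivity\<close>

context heyting_algebra
begin

lemma himp_greatest:
  assumes "x \<in> carrier L" "y \<in> carrier L"
  shows "greatest L (himp L x y) {w \<in> carrier L. w \<sqinter> x \<sqsubseteq> y}"
  unfolding himp_def using himp_exists[OF assms] by (rule someI_ex)

lemma himp_closed [simp]:
  "\<lbrakk>x \<in> carrier L; y \<in> carrier L\<rbrakk> \<Longrightarrow> himp L x y \<in> carrier L"
  using himp_greatest by (auto simp: greatest_def)

text \<open>Residuation: \<open>- \<sqinter> x\<close> is left adjoint to \<open>himp L x -\<close>.
  The forward direction is monotonicity of the meet followed by modus ponens.\<close>

lemma le_himp_iff:
  assumes "x \<in> carrier L" "y \<in> carrier L" "w \<in> carrier L"
  shows "w \<sqsubseteq> himp L x y \<longleftrightarrow> w \<sqinter> x \<sqsubseteq> y"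
proof
  have *: "himp L x y \<sqinter> x \<sqsubseteq> y"
    using himp_greatest[OF assms(1,2)] by (auto simp: greatest_def)
  assume "w \<sqsubseteq> himp L x y"
  then have "w \<sqinter> x \<sqsubseteq> himp L x y \<sqinter> x"
    using assms by (meson himp_closed le_trans meet_closed meet_le meet_left meet_right)
  then show "w \<sqinter> x \<sqsubseteq> y"
    using * assms by (meson himp_closed le_trans meet_closed)
next
  assume "w \<sqinter> x \<sqsubseteq> y"
  then show "w \<sqsubseteq> himp L x y"
    using himp_greatest[OF assms(1,2)] assms by (auto simp: greatest_def)
qed

lemma le_meet_iff:
  assumes "x \<in> carrier L" "y \<in> carrier L" "w \<in> carrier L"
  shows "w \<sqsubseteq> x \<sqinter> y \<longleftrightarrow> w \<sqsubseteq> x \<and> w \<sqsubseteq> y"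
  using assms by (meson le_trans meet_closed meet_le meet_left meet_right)

lemma join_le_iff:
  assumes "x \<in> carrier L" "y \<in> carrier L" "w \<in> carrier L"
  shows "x \<squnion> y \<sqsubseteq> w \<longleftrightarrow> x \<sqsubseteq> w \<and> y \<sqsubseteq> w"
  using assms by (meson le_trans join_closed join_le join_left join_right)

lemma meet_isotone:
  assumes "x \<in> carrier L" "x' \<in> carrier L" "y \<in> carrier L" "y' \<in> carrier L" "x \<sqsubseteq> x'" "y \<sqsubseteq> y'"
  shows "x \<sqinter> y \<sqsubseteq> x' \<sqinter> y'"
  using assms by (meson le_trans meet_closed meet_le meet_left meet_right)

text \<open>As a left adjoint, \<open>c \<sqinter> -\<close> preserves joins. The nontrivial
  inequality is moved across the adjunction, where it only asks for an upper bound of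
  \<open>x\<close> and \<open>y\<close>.\<close>

lemma meet_join_distrib:
  assumes "x \<in> carrier L" "y \<in> carrier L" "c \<in> carrier L"
  shows "c \<sqinter> (x \<squnion> y) = (c \<sqinter> x) \<squnion> (c \<sqinter> y)"
proof (rule le_antisym)
  let ?z = "(c \<sqinter> x) \<squnion> (c \<sqinter> y)"
  have "x \<sqsubseteq> himp L c ?z" "y \<sqsubseteq> himp L c ?z"
    using assms by (simp_all add: le_himp_iff meet_comm[of L _ c] join_left join_right)
  then have "x \<squnion> y \<sqsubseteq> himp L c ?z"
    using assms by (simp add: join_le_iff)
  then show "c \<sqinter> (x \<squnion> y) \<sqsubseteq> ?z"
    using assms by (simp add: le_himp_iff meet_comm[of L _ c])
  show "?z \<sqsubseteq> c \<sqinter> (x \<squnion> y)"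
    using assms by (simp add: join_le_iff meet_isotone join_left join_right)
qed (use assms in simp_all)

end

section \<open>Lattice structure and implication of a principal ideal\<close>

abbreviation ideal_below :: "('a, 'b) gorder_scheme \<Rightarrow> 'a \<Rightarrow> ('a, 'b) gorder_scheme" where
  "ideal_below L c \<equiv> L\<lparr>carrier := {a \<in> carrier L. a \<sqsubseteq>\<^bsub>L\<^esub> c}\<rparr>"

lemma (in partial_order) partial_order_ideal_below: "partial_order (ideal_below L c)"
proof -
  interpret S: weak_partial_order "ideal_below L c"
    by (rule weak_partial_order_subset[OF weak_partial_order_axioms]) auto
  show ?thesis
    by unfold_locales (simp add: eq_is_equal)
qed

locale heyting_ideal = heyting_algebra L for L :: "('a, 'b) gorder_scheme" (structure) +
  fixes c
  assumes c_closed [simp]: "c \<in> carrier L"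
begin

sublocale S: partial_order "ideal_below L c"
  by (rule partial_order_ideal_below)

lemma ideal_meet_closed:
  assumes "x \<in> carrier L" "y \<in> carrier L" "x \<sqsubseteq> c"
  shows "x \<sqinter> y \<sqsubseteq> c"
  using assms by (meson c_closed le_trans meet_closed meet_left)

lemma ideal_meet:
  assumes "x \<in> carrier (ideal_below L c)" "y \<in> carrier (ideal_below L c)"
  shows "x \<sqinter>\<^bsub>ideal_below L c\<^esub> y = x \<sqinter> y"
  using assms
  by (intro S.meet_eqI) (auto simp: ideal_meet_closed meet_left meet_right meet_le)

lemma ideal_join:
  assumes "x \<in> carrier (ideal_below L c)" "y \<in> carrier (ideal_below L c)"
  shows "x \<squnion>\<^bsub>ideal_below L c\<^esub> y = x \<squnion> y"
  using assms
  by (intro S.join_eqI) (auto simp: join_le_iff join_left join_right)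

lemma ideal_greatest: "greatest (ideal_below L c) c (carrier (ideal_below L c))"
  by (auto simp: greatest_def)

lemma ideal_least: "least (ideal_below L c) \<bottom> (carrier (ideal_below L c))"
  by (auto simp: least_def)

lemma ideal_top: "\<top>\<^bsub>ideal_below L c\<^esub> = c"
  unfolding top_def[of "ideal_below L c"]
  using ideal_greatest by (blast intro: some_equality S.greatest_unique)

lemma ideal_bottom: "\<bottom>\<^bsub>ideal_below L c\<^esub> = \<bottom>"
  unfolding bottom_def[of "ideal_below L c"]
  using ideal_least by (blast intro: some_equality S.least_unique)

text \<open>For \<open>w\<close> below \<open>c\<close>, residuation in \<open>L\<close> turns
  \<open>w \<sqinter> x \<sqsubseteq> y\<close> into
  \<open>w \<sqsubseteq> c \<sqinter> himp L x y\<close>. The set is therefore the down-set of an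
  element that itself lies in the ideal.\<close>

lemma ideal_himp_greatest:
  assumes "x \<in> carrier (ideal_below L c)" "y \<in> carrier (ideal_below L c)"
  shows "greatest (ideal_below L c) (c \<sqinter> himp L x y)
    {w \<in> carrier (ideal_below L c). w \<sqinter>\<^bsub>ideal_below L c\<^esub> x \<sqsubseteq>\<^bsub>ideal_below L c\<^esub> y}"
proof -
  have xy: "x \<in> carrier L" "y \<in> carrier L"
    using assms by auto
  have "w \<sqinter>\<^bsub>ideal_below L c\<^esub> x \<sqsubseteq> y \<longleftrightarrow> w \<sqsubseteq> c \<sqinter> himp L x y"
    if "w \<in> carrier (ideal_below L c)" for w
    using that assms xy by (simp add: ideal_meet le_himp_iff le_meet_iff)
  then have "{w \<in> carrier (ideal_below L c). w \<sqinter>\<^bsub>ideal_below L c\<^esub> x \<sqsubseteq>\<^bsub>ideal_below L c\<^esub> y}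
      = {w \<in> carrier L. w \<sqsubseteq> c \<and> w \<sqsubseteq> c \<sqinter> himp L x y}"
    by auto
  then show ?thesis
    using xy by (simp add: greatest_def meet_left subset_iff)
qed

lemma ideal_himp:
  assumes "x \<in> carrier (ideal_below L c)" "y \<in> carrier (ideal_below L c)"
  shows "himp (ideal_below L c) x y = c \<sqinter> himp L x y"
  using ideal_himp_greatest[OF assms] by (rule S.himp_eqI)

lemma heyting_algebra_ideal_below: "heyting_algebra (ideal_below L c)"
proof unfold_locales
  fix x y assume xy: "x \<in> carrier (ideal_below L c)" "y \<in> carrier (ideal_below L c)"
  show "\<exists>s. least (ideal_below L c) s (Upper (ideal_below L c) {x, y})"
    by (rule exI[where x = "x \<squnion> y"])
      (use xy in \<open>auto simp: least_def Upper_def join_le_iff join_left join_right\<close>)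
  show "\<exists>s. greatest (ideal_below L c) s (Lower (ideal_below L c) {x, y})"
    by (rule exI[where x = "x \<sqinter> y"])
      (use xy in \<open>auto simp: greatest_def Lower_def ideal_meet_closed meet_left meet_right meet_le\<close>)
  show "\<exists>z. greatest (ideal_below L c) z
    {w \<in> carrier (ideal_below L c). w \<sqinter>\<^bsub>ideal_below L c\<^esub> x \<sqsubseteq>\<^bsub>ideal_below L c\<^esub> y}"
    by (rule exI[where x = "c \<sqinter> himp L x y"]) (rule ideal_himp_greatest[OF xy])
next
  show "\<exists>x. least (ideal_below L c) x (carrier (ideal_below L c))"
    by (rule exI[where x = \<bottom>]) (rule ideal_least)
  show "\<exists>x. greatest (ideal_below L c) x (carrier (ideal_below L c))"
    by (rule exI[where x = c]) (rule ideal_greatest)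
qed

text \<open>Joins are preserved by distributivity, meets by idempotence of \<open>c\<close>.
  Implication is the substantial case, because the ideal computes it from
  \<open>c \<sqinter> a\<close> and \<open>c \<sqinter> b\<close>.\<close>

lemma preserves_heyting_meet: "preserves_heyting L (ideal_below L c) (\<lambda>a. c \<sqinter> a)"
proof -
  have mem: "c \<sqinter> a \<in> carrier (ideal_below L c)" if "a \<in> carrier L" for a
    using that by (simp add: meet_left)
  have top: "c \<sqinter> \<top> = c"
    by (rule meet_eqI) auto
  have bot: "c \<sqinter> \<bottom> = \<bottom>"
    by (rule meet_eqI) auto
  have meet: "c \<sqinter> (a \<sqinter> b) = (c \<sqinter> a) \<sqinter> (c \<sqinter> b)" if "a \<in> carrier L" "b \<in> carrier L" for a b
  proof (rule le_antisym)
    show "c \<sqinter> (a \<sqinter> b) \<sqsubseteq> (c \<sqinter> a) \<sqinter> (c \<sqinter> b)"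
      using that by (simp add: le_meet_iff[of "c \<sqinter> a"] meet_isotone meet_left meet_right)
    have "(c \<sqinter> a) \<sqinter> (c \<sqinter> b) \<sqsubseteq> c"
      using that by (simp add: ideal_meet_closed meet_left)
    then show "(c \<sqinter> a) \<sqinter> (c \<sqinter> b) \<sqsubseteq> c \<sqinter> (a \<sqinter> b)"
      using that by (simp add: le_meet_iff[of c] meet_isotone meet_right)
  qed (use that in auto)
  \<comment> \<open>By \<open>ideal_himp\<close> the right-hand side is the implication of
    \<open>c \<sqinter> a\<close> and \<open>c \<sqinter> b\<close> in the ideal.\<close>
  have himp: "c \<sqinter> himp L a b = c \<sqinter> himp L (c \<sqinter> a) (c \<sqinter> b)"
    if ab: "a \<in> carrier L" "b \<in> carrier L" for a b
  proof -
    \<comment> \<open>Both sides of the equation lie below \<open>c\<close>, so it suffices to test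
      them against elements \<open>w\<close> below \<open>c\<close>. For such \<open>w\<close>,
      meeting with \<open>c \<sqinter> a\<close> equals meeting with \<open>a\<close>, and the
      result is below \<open>c \<sqinter> b\<close> exactly when it is below
      \<open>b\<close>.\<close>
    have *: "w \<sqsubseteq> himp L a b \<longleftrightarrow> w \<sqsubseteq> himp L (c \<sqinter> a) (c \<sqinter> b)" if w: "w \<in> carrier L" "w \<sqsubseteq> c" for w
    proof -
      have eq: "w \<sqinter> (c \<sqinter> a) = w \<sqinter> a"
      proof (rule le_antisym)
        show "w \<sqinter> (c \<sqinter> a) \<sqsubseteq> w \<sqinter> a"
          using w ab by (intro meet_isotone) (auto simp: meet_right)
        have "w \<sqinter> a \<sqsubseteq> c"
          using w ab by (simp add: ideal_meet_closed)
        then show "w \<sqinter> a \<sqsubseteq> w \<sqinter> (c \<sqinter> a)"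
          using w ab by (simp add: le_meet_iff meet_left meet_right)
      qed (use w ab in auto)
      have "w \<sqinter> a \<sqsubseteq> c"
        using w ab by (simp add: ideal_meet_closed)
      then show ?thesis
        using w ab by (simp add: le_himp_iff eq le_meet_iff)
    qed
    show ?thesis
    proof (rule le_antisym)
      show "c \<sqinter> himp L a b \<sqsubseteq> c \<sqinter> himp L (c \<sqinter> a) (c \<sqinter> b)"
        using ab *[of "c \<sqinter> himp L a b"] by (simp add: le_meet_iff meet_left meet_right)
      show "c \<sqinter> himp L (c \<sqinter> a) (c \<sqinter> b) \<sqsubseteq> c \<sqinter> himp L a b"
        using ab *[of "c \<sqinter> himp L (c \<sqinter> a) (c \<sqinter> b)"] by (simp add: le_meet_iff meet_left meet_right)
    qed (use ab in auto)
  qed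
  show ?thesis
    unfolding preserves_heyting_def preserves_finite_meets_def
    by (intro conjI ballI)
      \<comment> \<open>The equation \<open>himp\<close> is reversed so that the term produced by
        \<open>ideal_himp\<close> folds back to \<open>c \<sqinter> himp L a b\<close>.\<close>
      (simp_all only: top bot meet himp[symmetric] meet_join_distrib c_closed mem ideal_top ideal_bottom
        ideal_meet ideal_join ideal_himp)
qed

end

section \<open>Composition of Heyting homomorphisms and restriction to ideals\<close>

lemma preserves_heyting_comp:
  assumes "preserves_heyting L M h" "preserves_heyting M N k" "h \<in> carrier L \<rightarrow> carrier M"
  shows "preserves_heyting L N (\<lambda>a. k (h a))"
  using assms unfolding preserves_heyting_def preserves_finite_meets_def by (auto simp: Pi_iff)

text \<open>Monotonicity puts the images in the ideal below \<open>h c\<close>. Meets, joins and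
  bottom are those of the ambient algebras, the top \<open>c\<close> goes to \<open>h c\<close>, and
  \<open>h\<close> carries the formula \<open>c \<sqinter> himp L x y\<close> to the same formula
  with bound \<open>h c\<close>.\<close>

lemma preserves_heyting_ideal_below:
  fixes L :: "('a, 'b) gorder_scheme" and M :: "('c, 'd) gorder_scheme"
  assumes "heyting_algebra L" "heyting_algebra M" "preserves_heyting L M h"
    and closed: "h \<in> carrier L \<rightarrow> carrier M" and iso: "isotone L M h" and c: "c \<in> carrier L"
  shows "preserves_heyting (ideal_below L c) (ideal_below M (h c)) h"
proof -
  interpret L: heyting_ideal L c
    using assms by (simp add: heyting_ideal_def heyting_ideal_axioms_def)
  interpret M: heyting_ideal M "h c"
    using assms by (auto simp add: heyting_ideal_def heyting_ideal_axioms_def)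
  have mem: "h x \<in> carrier (ideal_below M (h c))" if "x \<in> carrier (ideal_below L c)" for x
    using that closed c use_iso2[OF iso] by auto
  have sub: "x \<in> carrier L" if "x \<in> carrier (ideal_below L c)" for x
    using that by simp
  note h = assms(3)[unfolded preserves_heyting_def preserves_finite_meets_def]
  show ?thesis
    unfolding preserves_heyting_def preserves_finite_meets_def
  proof (intro conjI ballI)
    fix x y
    assume xy: "x \<in> carrier (ideal_below L c)" "y \<in> carrier (ideal_below L c)"
    show "h (x \<sqinter>\<^bsub>ideal_below L c\<^esub> y) = h x \<sqinter>\<^bsub>ideal_below M (h c)\<^esub> h y"
      using h sub xy by (simp only: L.ideal_meet M.ideal_meet mem)
    show "h (x \<squnion>\<^bsub>ideal_below L c\<^esub> y) = h x \<squnion>\<^bsub>ideal_below M (h c)\<^esub> h y"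
      using h sub xy by (simp only: L.ideal_join M.ideal_join mem)
    show "h (himp (ideal_below L c) x y) = himp (ideal_below M (h c)) (h x) (h y)"
      using h sub xy c by (simp only: L.ideal_himp M.ideal_himp mem L.himp_closed)
  qed (use h in \<open>simp_all only: L.ideal_top L.ideal_bottom M.ideal_top M.ideal_bottom\<close>)
qed

section \<open>The Kleisli category\<close>

locale kleisli_setting = finite_product_category C for C :: "('o, 'm) cat" +
  fixes \<pi> :: "('o, 'm) product_choice" and X :: 'o
  assumes chosen: "chosen_products C \<pi>"
    and X_Ob [simp]: "X \<in> Ob C"
begin

abbreviation times_X :: "'o \<Rightarrow> 'o" where
  "times_X A \<equiv> prod_ob \<pi> X A"

text \<open>The coKleisli extension of \<open>g\<close> for the comonad \<open>X \<times> -\<close>: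
  an arrow from \<open>X \<times> A\<close> to \<open>X \<times> B\<close> over
  \<open>X\<close>.\<close>

abbreviation extend :: "'o \<Rightarrow> 'o \<Rightarrow> 'm \<Rightarrow> 'm" where
  "extend A B g \<equiv> pairing C \<pi> (times_X A) X B (pr1 \<pi> X A) g"

lemma
  assumes "A \<in> Ob C"
  shows times_X_Ob [simp]: "times_X A \<in> Ob C"
    and pr1_Hom [simp]: "pr1 \<pi> X A \<in> Hom C (times_X A) X"
    and pr2_Hom [simp]: "pr2 \<pi> X A \<in> Hom C (times_X A) A"
  using assms chosen X_Ob by (auto simp: chosen_products_def is_product_def)

lemma times_X_ex1:
  assumes "Z \<in> Ob C" "B \<in> Ob C" "f \<in> Hom C Z X" "g \<in> Hom C Z B"
  shows "\<exists>!h. h \<in> Hom C Z (times_X B) \<and>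
    Compose C Z (times_X B) X (pr1 \<pi> X B) h = f \<and> Compose C Z (times_X B) B (pr2 \<pi> X B) h = g"
proof -
  have "is_product C X B (times_X B) (pr1 \<pi> X B) (pr2 \<pi> X B)"
    using assms chosen X_Ob by (auto simp: chosen_products_def)
  then show ?thesis
    using assms by (auto simp: is_product_def)
qed

lemma
  assumes "A \<in> Ob C" "B \<in> Ob C" "g \<in> Hom C (times_X A) B"
  shows extend_Hom [simp]: "extend A B g \<in> Hom C (times_X A) (times_X B)"
    and pr1_extend [simp]:
      "Compose C (times_X A) (times_X B) X (pr1 \<pi> X B) (extend A B g) = pr1 \<pi> X A"
    and pr2_extend [simp]:
      "Compose C (times_X A) (times_X B) B (pr2 \<pi> X B) (extend A B g) = g"
  using theI'[OF times_X_ex1[OF times_X_Ob[OF assms(1)] assms(2) pr1_Hom[OF assms(1)] assms(3)]]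
  by (simp_all add: pairing_def)

text \<open>The projections from \<open>X \<times> B\<close> are jointly monic; equations between
  extensions are checked on them.\<close>

lemma extend_unique:
  assumes "A \<in> Ob C" "B \<in> Ob C" "h \<in> Hom C (times_X A) (times_X B)"
    and "Compose C (times_X A) (times_X B) X (pr1 \<pi> X B) h = pr1 \<pi> X A"
    and "Compose C (times_X A) (times_X B) B (pr2 \<pi> X B) h = g"
  shows "extend A B g = h"
proof -
  have g: "g \<in> Hom C (times_X A) B"
    using assms by (auto intro: Compose_in_Hom)
  show ?thesis
    using times_X_ex1[OF times_X_Ob[OF assms(1)] assms(2) pr1_Hom[OF assms(1)] g]
      assms extend_Hom[OF assms(1,2) g] pr1_extend[OF assms(1,2) g] pr2_extend[OF assms(1,2) g]
    by blast
qed

lemma extend_pr2: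
  assumes "A \<in> Ob C"
  shows "extend A A (pr2 \<pi> X A) = Ident C (times_X A)"
  using assms by (intro extend_unique) (auto simp: Ident_in_Hom Compose_Ident_right)

text \<open>With \<open>extend_pr2\<close>, this makes \<open>extend\<close> functorial from the
  Kleisli category to \<open>C\<close>. Associativity of Kleisli composition and functoriality of
  the Kleisli reindexing both rest on it.\<close>

lemma extend_Compose:
  assumes "A \<in> Ob C" "B \<in> Ob C" "D \<in> Ob C" "g \<in> Hom C (times_X A) B" "h \<in> Hom C (times_X B) D"
  shows "extend A D (Compose C (times_X A) (times_X B) D h (extend A B g))
    = Compose C (times_X A) (times_X B) (times_X D) (extend B D h) (extend A B g)"
  using assms by (intro extend_unique) (auto intro: Compose_in_Hom simp: Compose_assoc)

lemma Ob_kleisli [simp]: "Ob (kleisli_category C \<pi> X) = Ob C"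
  and Hom_kleisli [simp]: "Hom (kleisli_category C \<pi> X) A B = Hom C (times_X A) B"
  and Ident_kleisli [simp]: "Ident (kleisli_category C \<pi> X) A = pr2 \<pi> X A"
  and Compose_kleisli [simp]: "Compose (kleisli_category C \<pi> X) A B D h g =
    Compose C (times_X A) (times_X B) D h (extend A B g)"
  by (simp_all add: kleisli_category_def)

sublocale K: category "kleisli_category C \<pi> X"
  by unfold_locales
    (auto simp: extend_pr2 Compose_Ident_right extend_Compose Compose_assoc intro: Compose_in_Hom)

section \<open>The canonical functor and finite products\<close>

lemma functor_hom_Hom [simp]:
  assumes "A \<in> Ob C" "B \<in> Ob C" "f \<in> Hom C A B"
  shows "kleisli_functor_hom C \<pi> X A B f \<in> Hom C (times_X A) B"
  using assms unfolding kleisli_functor_hom_def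
  by (meson Compose_in_Hom pr2_Hom times_X_Ob)

text \<open>Since \<open>pr2\<close> after the extension of \<open>g\<close> is \<open>g\<close>,
  Kleisli composition with an arrow coming from \<open>C\<close> is plain composition in
  \<open>C\<close>.\<close>

lemma functor_hom_comp_extend:
  assumes "A \<in> Ob C" "B \<in> Ob C" "D \<in> Ob C" "g \<in> Hom C (times_X A) B" "f \<in> Hom C B D"
  shows "Compose C (times_X A) (times_X B) D (kleisli_functor_hom C \<pi> X B D f) (extend A B g)
    = Compose C (times_X A) B D f g"
  using assms by (simp add: kleisli_functor_hom_def flip: Compose_assoc)

text \<open>A Kleisli arrow from \<open>A\<close> to \<open>T\<close> is an arrow from
  \<open>X \<times> A\<close> to \<open>T\<close> in \<open>C\<close>, hence unique.\<close>

lemma kleisli_terminal: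
  "is_terminal C T \<Longrightarrow> is_terminal (kleisli_category C \<pi> X) T"
  by (simp add: is_terminal_def)

text \<open>A Kleisli cone with vertex \<open>Z\<close> is a cone in \<open>C\<close> with vertex
  \<open>X \<times> Z\<close>, with the same mediating arrow. This yields both the existence of
  products in the Kleisli category and their preservation by the functor.\<close>

lemma kleisli_product:
  assumes "is_product C A B Q p q"
  shows "is_product (kleisli_category C \<pi> X) A B Q
    (kleisli_functor_hom C \<pi> X Q A p) (kleisli_functor_hom C \<pi> X Q B q)"
proof -
  have ob: "A \<in> Ob C" "B \<in> Ob C" "Q \<in> Ob C" and pq: "p \<in> Hom C Q A" "q \<in> Hom C Q B"
    and ex: "\<And>Z f g. \<lbrakk>Z \<in> Ob C; f \<in> Hom C Z A; g \<in> Hom C Z B\<rbrakk> \<Longrightarrow>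
      \<exists>!h. h \<in> Hom C Z Q \<and> Compose C Z Q A p h = f \<and> Compose C Z Q B q h = g"
    using assms by (auto simp: is_product_def)
  show ?thesis
    unfolding is_product_def
    \<comment> \<open>The congruence rule supplies the hom-set membership of the mediating arrow,
      which the rewriting of the two composites requires.\<close>
    using ob pq ex by (simp add: functor_hom_comp_extend cong: conj_cong)
qed

sublocale K: finite_product_category "kleisli_category C \<pi> X"
proof unfold_locales
  show "\<exists>T. is_terminal (kleisli_category C \<pi> X) T"
    using terminal_exists kleisli_terminal by blast
  show "\<exists>Q p q. is_product (kleisli_category C \<pi> X) A B Q p q"
    if "A \<in> Ob (kleisli_category C \<pi> X)" "B \<in> Ob (kleisli_category C \<pi> X)" for A B
    using that product_exists[of A B] kleisli_product by fastforce
qed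

sublocale F: finite_product_functor C "kleisli_category C \<pi> X"
  kleisli_functor_ob "kleisli_functor_hom C \<pi> X"
proof unfold_locales
  fix A B E f g
  assume a: "A \<in> Ob C" "B \<in> Ob C" "E \<in> Ob C" "f \<in> Hom C A B" "g \<in> Hom C B E"
  then show "kleisli_functor_hom C \<pi> X A E (Compose C A B E g f) =
      Compose (kleisli_category C \<pi> X) (kleisli_functor_ob A) (kleisli_functor_ob B)
        (kleisli_functor_ob E) (kleisli_functor_hom C \<pi> X B E g) (kleisli_functor_hom C \<pi> X A B f)"
    \<comment> \<open>The Kleisli composite is first reduced to one in \<open>C\<close>; unfolding
      the functor then leaves only associativity.\<close>
    by (simp add: kleisli_functor_ob_def functor_hom_comp_extend)
      (simp add: kleisli_functor_hom_def Compose_assoc)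
qed (auto simp: kleisli_functor_ob_def kleisli_terminal kleisli_product,
    simp add: kleisli_functor_hom_def Compose_Ident_left)

end

section \<open>The Kleisli doctrine of a Heyting doctrine\<close>

locale heyting_kleisli_setting =
  heyting_doctrine P + kleisli_setting "base P" \<pi> X
  for P :: "('o, 'm, 'e) doct" and \<pi> X +
  fixes \<phi>
  assumes phi_closed [simp]: "\<phi> \<in> carrier (fibre P X)"
begin

abbreviation K :: "('o, 'm, 'e) doct" where
  "K \<equiv> kleisli_doctrine P \<pi> X \<phi>"

abbreviation bound :: "'o \<Rightarrow> 'e" where
  "bound A \<equiv> reindex P (times_X A) X (pr1 \<pi> X A) \<phi>"

lemma base_K [simp]: "base K = kleisli_category (base P) \<pi> X"
  and fibre_K: "fibre K A = ideal_below (fibre P (times_X A)) (bound A)"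
  and reindex_K:
    "reindex K A B g = reindex P (times_X A) (times_X B) (extend A B g)"
  by (simp_all add: kleisli_doctrine_def)

lemma reindex_mem:
  assumes "A \<in> Ob (base P)" "B \<in> Ob (base P)" "f \<in> Hom (base P) A B" "\<alpha> \<in> carrier (fibre P B)"
  shows "reindex P A B f \<alpha> \<in> carrier (fibre P A)"
  using reindex_closed[OF assms(1-3)] assms(4) by auto

lemma bound_closed [simp]: "A \<in> Ob (base P) \<Longrightarrow> bound A \<in> carrier (fibre P (times_X A))"
  by (simp add: reindex_mem)

lemma heyting_ideal_fibre:
  "A \<in> Ob (base P) \<Longrightarrow> heyting_ideal (fibre P (times_X A)) (bound A)"
  by (simp add: heyting_ideal_def heyting_ideal_axioms_def fibre_heyting)

lemma heyting_fibre_K: "A \<in> Ob (base P) \<Longrightarrow> heyting_algebra (fibre K A)"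
  unfolding fibre_K by (rule heyting_ideal.heyting_algebra_ideal_below[OF heyting_ideal_fibre])

lemma partial_order_fibre_K: "A \<in> Ob (base P) \<Longrightarrow> partial_order (fibre K A)"
  unfolding fibre_K
  by (rule partial_order.partial_order_ideal_below) (simp add: fibre_partial_order)

text \<open>The extension of \<open>g\<close> commutes with the first projections, so functoriality
  of \<open>P\<close> sends the top of one Kleisli fibre to the top of the other.\<close>

lemma reindex_bound:
  assumes "A \<in> Ob (base P)" "B \<in> Ob (base P)" "g \<in> Hom (base P) (times_X A) B"
  shows "reindex P (times_X A) (times_X B) (extend A B g) (bound B) = bound A"
  using assms by (simp flip: reindex_Compose)

lemma isotone_fibre_K:
  assumes "A \<in> Ob (base P)" "B \<in> Ob (base P)" "g \<in> Hom (base P) (times_X A) B"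
  shows "isotone (fibre K B) (fibre K A) (reindex K A B g)"
proof -
  have "isotone (fibre P (times_X B)) (fibre P (times_X A)) (reindex K A B g)"
    unfolding reindex_K using assms by (simp add: reindex_isotone)
  then show ?thesis
    using assms partial_order_fibre_K[THEN partial_order.axioms(1)]
    by (auto simp: isotone_def) (auto simp: fibre_K)
qed

text \<open>Monotonicity carries an element below \<open>bound B\<close> to one below the reindexing
  of \<open>bound B\<close>, which is \<open>bound A\<close>.\<close>

lemma reindex_K_closed:
  assumes "A \<in> Ob (base P)" "B \<in> Ob (base P)" "g \<in> Hom (base P) (times_X A) B"
  shows "reindex K A B g \<in> carrier (fibre K B) \<rightarrow> carrier (fibre K A)"
proof
  fix \<alpha> assume "\<alpha> \<in> carrier (fibre K B)"
  then have \<alpha>: "\<alpha> \<in> carrier (fibre P (times_X B))" "\<alpha> \<sqsubseteq>\<^bsub>fibre P (times_X B)\<^esub> bound B"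
    by (auto simp: fibre_K)
  have "isotone (fibre P (times_X B)) (fibre P (times_X A)) (reindex K A B g)"
    unfolding reindex_K using assms by (simp add: reindex_isotone)
  from use_iso2[OF this \<alpha>(1) _ \<alpha>(2)] assms
  have "reindex K A B g \<alpha> \<sqsubseteq>\<^bsub>fibre P (times_X A)\<^esub> bound A"
    by (simp add: reindex_K reindex_bound)
  then show "reindex K A B g \<alpha> \<in> carrier (fibre K A)"
    using assms \<alpha> by (simp add: fibre_K reindex_K reindex_mem)
qed

sublocale KD: heyting_doctrine K
proof (intro heyting_doctrine.intro doctrine.intro doctrine_axioms.intro
    heyting_doctrine_axioms.intro, unfold base_K)
  show "finite_product_category (kleisli_category (base P) \<pi> X)" ..
next
  fix A B D f g \<alpha>
  assume "A \<in> Ob (kleisli_category (base P) \<pi> X)" "B \<in> Ob (kleisli_category (base P) \<pi> X)"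
    "D \<in> Ob (kleisli_category (base P) \<pi> X)" "f \<in> Hom (kleisli_category (base P) \<pi> X) A B"
    "g \<in> Hom (kleisli_category (base P) \<pi> X) B D" "\<alpha> \<in> carrier (fibre K D)"
  then show "reindex K A D (Compose (kleisli_category (base P) \<pi> X) A B D g f) \<alpha> =
      reindex K A B f (reindex K B D g \<alpha>)"
    by (simp add: reindex_K extend_Compose reindex_Compose fibre_K)
next
  fix A B f
  assume "A \<in> Ob (kleisli_category (base P) \<pi> X)" "B \<in> Ob (kleisli_category (base P) \<pi> X)"
    "f \<in> Hom (kleisli_category (base P) \<pi> X) A B"
  then have a: "A \<in> Ob (base P)" "B \<in> Ob (base P)" "f \<in> Hom (base P) (times_X A) B"
    by simp_all
  show "preserves_heyting (fibre K B) (fibre K A) (reindex K A B f)"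
    \<comment> \<open>Restriction to ideals is applied with \<open>h\<close> the reindexing along
      the extension and \<open>c\<close> the element \<open>bound B\<close>;
      \<open>reindex_bound\<close> then identifies \<open>h c\<close> with
      \<open>bound A\<close>.\<close>
    using a preserves_heyting_ideal_below[of "fibre P (times_X B)" "fibre P (times_X A)"
        "reindex P (times_X A) (times_X B) (extend A B f)" "bound B"]
    unfolding fibre_K reindex_K reindex_bound[OF a]
    by (simp add: fibre_heyting reindex_heyting reindex_closed reindex_isotone)
qed (auto simp: partial_order_fibre_K reindex_K_closed[unfolded Pi_iff, rule_format]
    isotone_fibre_K heyting_fibre_K,
    simp add: reindex_K extend_pr2 reindex_Ident fibre_K)

section \<open>The canonical 1-arrow\<close>

lemma component_mem:
  assumes "A \<in> Ob (base P)" "\<alpha> \<in> carrier (fibre P A)"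
  shows "kleisli_component P \<pi> X \<phi> A \<alpha> \<in> carrier (fibre K A)"
proof -
  interpret L: heyting_ideal "fibre P (times_X A)" "bound A"
    by (rule heyting_ideal_fibre[OF assms(1)])
  show ?thesis
    using assms by (simp add: fibre_K kleisli_component_def reindex_mem L.meet_left)
qed

text \<open>The component factors as reindexing along \<open>pr2\<close> followed by the meet with
  \<open>bound A\<close>, each a Heyting homomorphism.\<close>

lemma component_preserves_heyting:
  assumes "A \<in> Ob (base P)"
  shows "preserves_heyting (fibre P A) (fibre K A) (kleisli_component P \<pi> X \<phi> A)"
proof -
  let ?L = "fibre P (times_X A)"
  have "preserves_heyting (fibre P A) ?L (reindex P (times_X A) A (pr2 \<pi> X A))"
    "reindex P (times_X A) A (pr2 \<pi> X A) \<in> carrier (fibre P A) \<rightarrow> carrier ?L"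
    using assms by (simp_all add: reindex_heyting reindex_closed)
  from preserves_heyting_comp[OF this(1) heyting_ideal.preserves_heyting_meet[OF
        heyting_ideal_fibre[OF assms]] this(2)]
  show ?thesis
    unfolding kleisli_component_def[abs_def] fibre_K .
qed

lemma component_is_isotone:
  assumes "A \<in> Ob (base P)"
  shows "isotone (fibre P A) (fibre K A) (kleisli_component P \<pi> X \<phi> A)"
proof (rule isotoneI)
  show "weak_partial_order (fibre P A)" "weak_partial_order (fibre K A)"
    using assms fibre_partial_order partial_order_fibre_K by (auto dest: partial_order.axioms(1))
next
  interpret L: heyting_ideal "fibre P (times_X A)" "bound A"
    by (rule heyting_ideal_fibre[OF assms(1)])
  have iso: "isotone (fibre P A) (fibre P (times_X A)) (reindex P (times_X A) A (pr2 \<pi> X A))"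
    using assms by (simp add: reindex_isotone)
  fix x y
  assume "x \<in> carrier (fibre P A)" "y \<in> carrier (fibre P A)" "x \<sqsubseteq>\<^bsub>fibre P A\<^esub> y"
  then show "kleisli_component P \<pi> X \<phi> A x \<sqsubseteq>\<^bsub>fibre K A\<^esub> kleisli_component P \<pi> X \<phi> A y"
    using assms use_iso2[OF iso, of x y]
    by (simp add: fibre_K kleisli_component_def reindex_mem L.meet_isotone)
qed

text \<open>Reindexing along the extension preserves the meet and takes \<open>bound B\<close> to
  \<open>bound A\<close>. What remains is functoriality of \<open>P\<close> for two factorisations
  of \<open>?g\<close>: as \<open>pr2\<close> after its extension, and as \<open>f\<close> after
  \<open>pr2\<close>.\<close>

lemma component_natural:
  assumes a: "A \<in> Ob (base P)" "B \<in> Ob (base P)" "f \<in> Hom (base P) A B" "\<alpha> \<in> carrier (fibre P B)"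
  shows "kleisli_component P \<pi> X \<phi> A (reindex P A B f \<alpha>) =
    reindex K A B (kleisli_functor_hom (base P) \<pi> X A B f) (kleisli_component P \<pi> X \<phi> B \<alpha>)"
proof -
  let ?g = "kleisli_functor_hom (base P) \<pi> X A B f"
  have g: "?g \<in> Hom (base P) (times_X A) B"
    using a by simp
  have "preserves_finite_meets (fibre P (times_X B)) (fibre P (times_X A))
      (reindex P (times_X A) (times_X B) (extend A B ?g))"
    using a by (simp add: reindex_heyting[unfolded preserves_heyting_def])
  then have "reindex K A B ?g (kleisli_component P \<pi> X \<phi> B \<alpha>) =
      bound A \<sqinter>\<^bsub>fibre P (times_X A)\<^esub> reindex P (times_X A) (times_X B) (extend A B ?g)
        (reindex P (times_X B) B (pr2 \<pi> X B) \<alpha>)"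
    using a g unfolding preserves_finite_meets_def
    by (simp add: kleisli_component_def reindex_K reindex_bound reindex_mem)
  also have "reindex P (times_X A) (times_X B) (extend A B ?g) (reindex P (times_X B) B (pr2 \<pi> X B) \<alpha>)
      = reindex P (times_X A) B ?g \<alpha>"
    using a g by (simp flip: reindex_Compose)
  also have "\<dots> = reindex P (times_X A) A (pr2 \<pi> X A) (reindex P A B f \<alpha>)"
    using a by (simp add: kleisli_functor_hom_def reindex_Compose)
  finally show ?thesis
    by (simp add: kleisli_component_def)
qed

lemma kleisli_heyting_doctrine_hom:
  "heyting_doctrine_hom P K kleisli_functor_ob (kleisli_functor_hom (base P) \<pi> X)
    (kleisli_component P \<pi> X \<phi>)"
proof (intro heyting_doctrine_hom.intro doctrine_hom.intro doctrine_hom_axioms.intro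
    heyting_doctrine_hom_axioms.intro)
  show "finite_product_functor (base P) (base K) kleisli_functor_ob (kleisli_functor_hom (base P) \<pi> X)"
    unfolding base_K ..
qed (auto simp: kleisli_functor_ob_def component_mem component_is_isotone component_natural
    component_preserves_heyting intro: doctrine_axioms KD.doctrine_axioms heyting_doctrine_axioms
    KD.heyting_doctrine_axioms)

end

theorem corollary5p10:
  fixes P :: "('o, 'm, 'e) doct"
    and \<pi> :: "('o, 'm) product_choice"
    and X :: 'o
    and \<phi> :: 'e
  assumes "primary_doctrine P"
    and "chosen_products (base P) \<pi>"
    and "X \<in> Ob (base P)"
    and "\<phi> \<in> carrier (fibre P X)"
    and "heyting_doctrine P"
  shows "heyting_doctrine (kleisli_doctrine P \<pi> X \<phi>)
    \<and> heyting_doctrine_hom P (kleisli_doctrine P \<pi> X \<phi>)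
        kleisli_functor_ob (kleisli_functor_hom (base P) \<pi> X) (kleisli_component P \<pi> X \<phi>)"
proof -
  interpret heyting_doctrine P
    by fact
  interpret heyting_kleisli_setting P \<pi> X \<phi>
    using assms by unfold_locales
  show ?thesis
    using KD.heyting_doctrine_axioms kleisli_heyting_doctrine_hom by simp
qed

end
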